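(* Let $d \in \{1, 2, \ldots, n-1\}$. If $K$ is a compact convex subset of $\mathbb{R}^n$ having at least $d+2$ exposed points, then there exists a compact convex set $L \subseteq \mathbb{R}^n$ such that the projection $L_\xi$ contains a translate of the projection $K_\xi$ for each $d$-dimensional linear subspace $\xi$, while $L$ does not contain a translate of $K$.
   Context: For a set $S\subseteq\mathbb{R}^n$ and a linear subspace $\xi$, $S_\xi$ denotes the orthogonal projection of $S$ onto $\xi$. A point $x\in K$ is an exposed point of $K$ if there is a unit vector $u$ such that $x$ is the unique point of $K$ maximizing $y\mapsto y\cdot u$ over $K$. *)

theory Defs
  imports "HOL-Analysis.Analysis"
begin

definition exposed_point_of :: "'a::euclidean_space \<Rightarrow> 'a set \<Rightarrow> bool" where
  "exposed_point_of x K \<longleftrightarrow> x \<in> K \<and>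
     (\<exists>u. norm u = 1 \<and> (\<forall>y\<in>K. y \<noteq> x \<longrightarrow> y \<bullet> u < x \<bullet> u))"

definition orth_proj :: "'a::euclidean_space set \<Rightarrow> 'a \<Rightarrow> 'a" where
  "orth_proj xi x = (THE y. y \<in> xi \<and> (\<forall>z\<in>xi. orthogonal (x - y) z))"

definition proj_set :: "'a::euclidean_space set \<Rightarrow> 'a set \<Rightarrow> 'a set" where
  "proj_set xi S = orth_proj xi ` S"

end

theory Submission
  imports Defs
begin

text \<open>
  By Helly's theorem inside \<open>xi\<close>, it suffices that \<open>L\<close> contains a translate of every subset of \<open>K\<close>
  with at most \<open>d + 1\<close> points, but not of \<open>K\<close> itself. From \<open>d + 2\<close> exposed points one obtains
  \<open>d + 2\<close> directions \<open>u\<^sub>i\<close> with sum zero whose faces of \<open>K\<close> are pairwise disjoint. After a small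
  perturbation any \<open>d + 1\<close> of them are linearly independent, so that there are vectors \<open>t\<^sub>j\<close> with
  \<open>t\<^sub>j \<bullet> u\<^sub>i = -1\<close> for all \<open>i \<noteq> j\<close>. Let \<open>T\<^sub>j\<close> be \<open>K\<close> without a small cap in direction \<open>u\<^sub>j\<close>, and let
  \<open>L\<close> be the convex hull of the translates \<open>h t\<^sub>j + T\<^sub>j\<close> with \<open>h\<close> small. The caps are disjoint, so
  \<open>d + 1\<close> points miss one of them and lie in some \<open>T\<^sub>j\<close>. On the other hand the support function of
  \<open>L\<close> is smaller than that of \<open>K\<close> at every \<open>u\<^sub>i\<close>, and since the \<open>u\<^sub>i\<close> sum to zero this excludes
  all translates of \<open>K\<close>.
\<close>

section \<open>Projections and small subsets\<close>

lemma orth_proj_eqI: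
  assumes "subspace xi" "y \<in> xi" "\<And>z. z \<in> xi \<Longrightarrow> orthogonal (x - y) z"
  shows "orth_proj xi x = y"
  unfolding orth_proj_def
proof (rule the_equality)
  show "y \<in> xi \<and> (\<forall>z\<in>xi. orthogonal (x - y) z)"
    using assms by blast
next
  fix y' assume y': "y' \<in> xi \<and> (\<forall>z\<in>xi. orthogonal (x - y') z)"
  then have "y' - y \<in> xi"
    using assms by (simp add: subspace_diff)
  then have "(x - y) \<bullet> (y' - y) = 0" "(x - y') \<bullet> (y' - y) = 0"
    using assms(3) y' by (auto simp: orthogonal_def)
  then have "(y' - y) \<bullet> (y' - y) = 0"
    by (simp add: inner_diff_left)
  then show "y' = y" by simp
qed

lemma orth_proj_mem_orthogonal:
  assumes "subspace xi"
  shows "orth_proj xi x \<in> xi \<and> (\<forall>z\<in>xi. orthogonal (x - orth_proj xi x) z)"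
proof -
  obtain y z where yz: "y \<in> span xi" "\<And>w. w \<in> span xi \<Longrightarrow> orthogonal z w" "x = y + z"
    using orthogonal_subspace_decomp_exists by blast
  moreover have "span xi = xi"
    using assms by (simp add: span_eq_iff)
  ultimately have "orth_proj xi x = y"
    using assms by (intro orth_proj_eqI) auto
  with yz \<open>span xi = xi\<close> show ?thesis by auto
qed

lemma linear_orth_proj:
  assumes "subspace xi"
  shows "linear (orth_proj xi)"
proof (rule linearI)
  note m = orth_proj_mem_orthogonal[OF assms]
  fix x y :: 'a and c :: real
  show "orth_proj xi (x + y) = orth_proj xi x + orth_proj xi y"
  proof (rule orth_proj_eqI[OF assms])
    show "orth_proj xi x + orth_proj xi y \<in> xi"
      using assms m by (simp add: subspace_add)
  next
    fix z assume "z \<in> xi"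
    then show "orthogonal (x + y - (orth_proj xi x + orth_proj xi y)) z"
      using m[of x] m[of y] by (auto simp: orthogonal_def inner_diff_left inner_add_left)
  qed
  show "orth_proj xi (c *\<^sub>R x) = c *\<^sub>R orth_proj xi x"
  proof (rule orth_proj_eqI[OF assms])
    show "c *\<^sub>R orth_proj xi x \<in> xi"
      using assms m by (simp add: subspace_scale)
  next
    fix z assume "z \<in> xi"
    then show "orthogonal (c *\<^sub>R x - c *\<^sub>R orth_proj xi x) z"
      using m[of x] by (auto simp: orthogonal_def inner_diff_left)
  qed
qed

text \<open>Radon's argument, with \<open>dim V\<close> in place of the ambient dimension: dropping
  one index at a time gives points \<open>X i\<close> of \<open>V\<close>. More than
  \<open>dim V + 1\<close> such points are affinely dependent, and a common point of the hulls of
  the two Radon parts lies in every \<open>C j\<close>.\<close>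

lemma Helly_subspace:
  fixes C :: "'i \<Rightarrow> 'a::euclidean_space set"
  assumes "subspace V" "finite A" "\<And>i. i \<in> A \<Longrightarrow> convex (C i)"
    and "\<And>J. J \<subseteq> A \<Longrightarrow> card J \<le> dim V + 1 \<Longrightarrow> \<exists>x\<in>V. \<forall>i\<in>J. x \<in> C i"
  shows "\<exists>x\<in>V. \<forall>i\<in>A. x \<in> C i"
  using assms(2-4)
proof (induction A rule: finite_psubset_induct)
  case (psubset A)
  show ?case
  proof (cases "card A \<le> dim V + 1")
    case True
    then show ?thesis using psubset.prems(2)[of A] by blast
  next
    case False
    have "\<exists>x\<in>V. \<forall>j\<in>A - {i}. x \<in> C j" if "i \<in> A" for i
    proof (rule psubset.IH)
      show "A - {i} \<subset> A" using that by blast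
      show "\<And>i'. i' \<in> A - {i} \<Longrightarrow> convex (C i')" using psubset.prems by blast
      show "\<And>J. J \<subseteq> A - {i} \<Longrightarrow> card J \<le> dim V + 1 \<Longrightarrow> \<exists>x\<in>V. \<forall>i\<in>J. x \<in> C i"
        using psubset.prems(2) by blast
    qed
    then obtain X where X: "\<And>i. i \<in> A \<Longrightarrow> X i \<in> V" "\<And>i j. i \<in> A \<Longrightarrow> j \<in> A \<Longrightarrow> i \<noteq> j \<Longrightarrow> X i \<in> C j"
      by (metis Diff_iff singletonD)
    show ?thesis
    proof (cases "inj_on X A")
      case False
      then obtain i j where "i \<in> A" "j \<in> A" "i \<noteq> j" "X i = X j"
        unfolding inj_on_def by blast
      \<comment> \<open>Every \<open>k\<close> differs from \<open>i\<close> or from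
        \<open>j\<close>, so the coinciding point lies in each set.\<close>
      then have "X i \<in> C k" if "k \<in> A" for k
        using X(2) that by metis
      with X(1) \<open>i \<in> A\<close> show ?thesis by blast
    next
      case True
      have "X ` A \<subseteq> V" using X by blast
      then have "dim (X ` A) \<le> dim V" by (rule dim_subset)
      with \<open>\<not> card A \<le> dim V + 1\<close> have "affine_dependent (X ` A)"
        using psubset.hyps by (intro affine_dependent_biggerset_general) (auto simp: card_image[OF True])
      from Radon_partition[OF _ this] psubset.hyps obtain M P where MP: "M \<inter> P = {}" "M \<union> P = X ` A"
          "(convex hull M) \<inter> (convex hull P) \<noteq> {}"
        by auto
      then obtain p where p: "p \<in> convex hull M" "p \<in> convex hull P" by blast
      have "convex hull M \<subseteq> V"
        using MP \<open>X ` A \<subseteq> V\<close> assms(1) by (intro hull_minimal subspace_imp_convex) auto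
      moreover have "p \<in> C j" if j: "j \<in> A" for j
      proof -
        \<comment> \<open>All points except possibly \<open>X j\<close> lie in \<open>C j\<close>,
          and the disjoint parts cannot both contain \<open>X j\<close>.\<close>
        have hull: "convex hull S \<subseteq> C j" if "S \<subseteq> X ` A" "X j \<notin> S" for S
        proof (rule hull_minimal)
          show "S \<subseteq> C j" using that X(2) j by blast
          show "convex (C j)" using j psubset.prems by blast
        qed
        have "M \<subseteq> X ` A" "P \<subseteq> X ` A" "X j \<notin> M \<or> X j \<notin> P"
          using MP(1,2) by auto
        then show ?thesis using hull[of M] hull[of P] p by blast
      qed
      ultimately show ?thesis using p by blast
    qed
  qed
qed

lemma linear_image_contains_translate:
  fixes K L :: "'a::euclidean_space set" and P :: "'a \<Rightarrow> 'a"
  assumes P: "linear P" and V: "subspace V" "range P \<subseteq> V"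
    and L: "compact L" "convex L"
    and sub: "\<And>Q. finite Q \<Longrightarrow> Q \<subseteq> K \<Longrightarrow> card Q \<le> dim V + 1 \<Longrightarrow> \<exists>t. (+) t ` Q \<subseteq> L"
  shows "\<exists>t. (+) t ` P ` K \<subseteq> P ` L"
proof (cases "K = {}")
  case False
  then obtain x0 where x0: "x0 \<in> K" by blast
  define C where "C x = (+) (- P x) ` P ` L" for x
  have cmp: "compact (C x)" for x
    unfolding C_def using P L
    by (intro compact_translation compact_continuous_image linear_continuous_on) (auto simp: linear_linear)
  have cvx: "convex (C x)" for x
    unfolding C_def using P L by (intro convex_translation convex_linear_image)
  have "C x0 \<inter> (\<Inter>x\<in>K. C x) \<noteq> {}"
  proof (rule compact_imp_fip_image[OF cmp])
    show "closed (C x)" for x using cmp compact_imp_closed by blast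
  next
    fix I assume I: "finite I" "I \<subseteq> K"
    have "\<exists>s\<in>V. \<forall>x\<in>insert x0 I. s \<in> C x"
    proof (rule Helly_subspace[OF V(1)])
      fix J assume J: "J \<subseteq> insert x0 I" "card J \<le> dim V + 1"
      then have "finite J" using I finite_subset by blast
      then obtain t where t: "(+) t ` J \<subseteq> L"
        using sub[of J] J I x0 by blast
      have "P t = - P x + P (t + x)" for x
        by (simp add: linear_add[OF P])
      then have "\<forall>x\<in>J. P t \<in> C x"
        unfolding C_def using t by blast
      then show "\<exists>s\<in>V. \<forall>x\<in>J. s \<in> C x" using V by blast
    qed (use I cvx in auto)
    then show "C x0 \<inter> (\<Inter>x\<in>I. C x) \<noteq> {}" by blast
  qed
  then obtain s where "\<And>x. x \<in> K \<Longrightarrow> s \<in> C x" by blast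
  then have "s + P x \<in> P ` L" if "x \<in> K" for x
    using that unfolding C_def by force
  then show ?thesis by blast
qed auto

section \<open>Approximate faces\<close>

text \<open>For \<open>e = 0\<close> this is the face of \<open>K\<close> in direction
  \<open>u\<close>; for \<open>e > 0\<close> it is a closed cap of depth \<open>e\<close>.\<close>

definition near_face :: "'a::euclidean_space set \<Rightarrow> 'a \<Rightarrow> real \<Rightarrow> 'a set" where
  "near_face K u e = {x \<in> K. \<forall>y\<in>K. y \<bullet> u \<le> x \<bullet> u + e}"

lemma near_face_mono: "e \<le> e' \<Longrightarrow> near_face K u e \<subseteq> near_face K u e'"
  unfolding near_face_def by fastforce

lemma near_face_scale: "c > 0 \<Longrightarrow> near_face K (c *\<^sub>R u) 0 = near_face K u 0"
  unfolding near_face_def by auto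

text \<open>Otherwise common points exist for tolerances tending to zero, and a limit of a
  subsequence lies in both exact faces. The same \<open>e\<close> bounds the change of direction and
  the depth of the cap.\<close>

lemma disjoint_near_face_stable_pair:
  fixes K :: "'a::euclidean_space set"
  assumes K: "compact K" and disj: "near_face K u 0 \<inter> near_face K v 0 = {}"
  shows "\<exists>e>0. \<forall>u' v'. dist u' u < e \<longrightarrow> dist v' v < e \<longrightarrow> near_face K u' e \<inter> near_face K v' e = {}"
proof (rule ccontr)
  assume neg: "\<not> ?thesis"
  have "\<exists>u' v' x. dist u' u < inverse (Suc n) \<and> dist v' v < inverse (Suc n) \<and>
      x \<in> near_face K u' (inverse (Suc n)) \<and> x \<in> near_face K v' (inverse (Suc n))" for n
  proof -
    have "inverse (real (Suc n)) > 0" by simp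
    with neg show ?thesis by (meson disjoint_iff)
  qed
  then obtain U W X where
    U: "\<And>n. dist (U n) u < inverse (Suc n)" and W: "\<And>n. dist (W n) v < inverse (Suc n)" and
    X: "\<And>n. X n \<in> near_face K (U n) (inverse (Suc n))" "\<And>n. X n \<in> near_face K (W n) (inverse (Suc n))"
    by metis
  have XK: "\<forall>n. X n \<in> K" using X unfolding near_face_def by blast
  then obtain l r where l: "l \<in> K" and r: "strict_mono r" and lim: "(X \<circ> r) \<longlonglongrightarrow> l"
    using K unfolding compact_def by metis
  have inv: "(\<lambda>n. inverse (real (Suc (r n)))) \<longlonglongrightarrow> 0"
    using LIMSEQ_subseq_LIMSEQ[OF LIMSEQ_inverse_real_of_nat r] by (simp add: o_def)
  have lim': "(\<lambda>n. X (r n)) \<longlonglongrightarrow> l" using lim by (simp add: o_def)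
  have face: "l \<in> near_face K w 0"
    if F: "\<And>n. dist (F n) w < inverse (Suc n)" and XF: "\<And>n. X n \<in> near_face K (F n) (inverse (Suc n))"
    for F w
  proof -
    have "(\<lambda>n. dist (F (r n)) w) \<longlonglongrightarrow> 0"
      by (rule tendsto_sandwich[OF _ _ tendsto_const inv]) (use F in \<open>auto intro!: always_eventually less_imp_le\<close>)
    then have Flim: "(\<lambda>n. F (r n)) \<longlonglongrightarrow> w"
      using tendsto_dist_iff by blast
    have "y \<bullet> w \<le> l \<bullet> w + 0" if y: "y \<in> K" for y
    proof (rule LIMSEQ_le)
      show "(\<lambda>n. y \<bullet> F (r n)) \<longlonglongrightarrow> y \<bullet> w"
        by (intro tendsto_intros Flim)
      show "(\<lambda>n. X (r n) \<bullet> F (r n) + inverse (Suc (r n))) \<longlonglongrightarrow> l \<bullet> w + 0"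
        by (intro tendsto_intros Flim lim' inv)
      show "\<exists>N. \<forall>n\<ge>N. y \<bullet> F (r n) \<le> X (r n) \<bullet> F (r n) + inverse (Suc (r n))"
        using XF y unfolding near_face_def by blast
    qed
    then show ?thesis using l unfolding near_face_def by auto
  qed
  show False
    using face[OF U X(1)] face[OF W X(2)] disj by blast
qed

lemma disjoint_near_face_stable:
  fixes K :: "'a::euclidean_space set" and u :: "'i \<Rightarrow> 'a"
  assumes K: "compact K" and I: "finite I"
    and disj: "disjoint_family_on (\<lambda>i. near_face K (u i) 0) I"
  shows "\<exists>e>0. \<forall>u'. (\<forall>i\<in>I. dist (u' i) (u i) < e) \<longrightarrow> disjoint_family_on (\<lambda>i. near_face K (u' i) e) I"
proof -
  define Z where "Z = {p \<in> I \<times> I. fst p \<noteq> snd p}"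
  have "finite Z" unfolding Z_def using I by simp
  have "\<exists>e>0. \<forall>u' v'. dist u' (u (fst p)) < e \<longrightarrow> dist v' (u (snd p)) < e \<longrightarrow>
      near_face K u' e \<inter> near_face K v' e = {}" if "p \<in> Z" for p
  proof (rule disjoint_near_face_stable_pair[OF K])
    show "near_face K (u (fst p)) 0 \<inter> near_face K (u (snd p)) 0 = {}"
      using that disj unfolding Z_def disjoint_family_on_def by force
  qed
  then have "\<exists>f. \<forall>p\<in>Z. f p > 0 \<and> (\<forall>u' v'. dist u' (u (fst p)) < f p \<longrightarrow>
      dist v' (u (snd p)) < f p \<longrightarrow> near_face K u' (f p) \<inter> near_face K v' (f p) = {})"
    by (intro bchoice ballI)
  then obtain f where f: "\<And>p. p \<in> Z \<Longrightarrow> f p > 0"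
    "\<And>p u' v'. p \<in> Z \<Longrightarrow> dist u' (u (fst p)) < f p \<Longrightarrow> dist v' (u (snd p)) < f p \<Longrightarrow>
      near_face K u' (f p) \<inter> near_face K v' (f p) = {}"
    by blast
  \<comment> \<open>The element 1 keeps the minimum defined when there are no pairs.\<close>
  define e where "e = Min (insert 1 (f ` Z))"
  have "e > 0" unfolding e_def using \<open>finite Z\<close> f(1) by (subst Min_gr_iff) auto
  have e: "e \<le> f p" if "p \<in> Z" for p
    unfolding e_def using \<open>finite Z\<close> that by simp
  have "near_face K (u' i) e \<inter> near_face K (u' j) e = {}"
    if "\<forall>i\<in>I. dist (u' i) (u i) < e" "i \<in> I" "j \<in> I" "i \<noteq> j" for u' i j
  proof -
    have p: "(i, j) \<in> Z" using that unfolding Z_def by simp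
    have "dist (u' i) (u i) < f (i, j)" "dist (u' j) (u j) < f (i, j)"
      using that e[OF p] by (meson less_le_trans)+
    then have "near_face K (u' i) (f (i, j)) \<inter> near_face K (u' j) (f (i, j)) = {}"
      using f(2)[OF p] by simp
    then show ?thesis using near_face_mono[OF e[OF p]] by blast
  qed
  with \<open>e > 0\<close> show ?thesis unfolding disjoint_family_on_def by blast
qed

section \<open>Perturbation to general position\<close>

text \<open>Solvability for all \<open>c\<close> expresses linear independence of the indexed family
  in dual form. Each new vector is pushed, if necessary, along a normal \<open>p\<close> of the span
  of the earlier ones.\<close>

lemma perturb_to_independent:
  fixes v :: "'i \<Rightarrow> 'a::euclidean_space"
  assumes "finite J" "card J \<le> DIM('a)" "e > 0"
  shows "\<exists>v'. (\<forall>i\<in>J. dist (v' i) (v i) < e) \<and> (\<forall>c. \<exists>t. \<forall>i\<in>J. t \<bullet> v' i = c i)"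
  using assms
proof (induction J rule: finite_induct)
  case empty
  then show ?case by auto
next
  case (insert k J)
  then obtain v' where v': "\<And>i. i \<in> J \<Longrightarrow> dist (v' i) (v i) < e"
      and c: "\<And>c. \<exists>t. \<forall>i\<in>J. t \<bullet> v' i = c i"
    by auto
  have "dim (v' ` J) \<le> card (v' ` J)"
    using insert by (intro dim_le_card') auto
  also have "\<dots> \<le> card J" using insert by (intro card_image_le)
  also have "\<dots> < DIM('a)" using insert by simp
  finally obtain p where p: "p \<noteq> 0" "\<And>y. y \<in> span (v' ` J) \<Longrightarrow> orthogonal p y"
    using orthogonal_to_subspace_exists by blast
  have p0: "p \<bullet> v' i = 0" if "i \<in> J" for i
    using p(2)[of "v' i"] that by (simp add: orthogonal_def span_base)
  define h where "h = e / (2 * norm p)"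
  have h: "h > 0" "h * norm p < e" unfolding h_def using p insert.prems by auto
  obtain w where w: "dist w (v k) < e" "p \<bullet> w \<noteq> 0"
  proof (cases "p \<bullet> v k = 0")
    case True
    show ?thesis
    proof (rule that[of "v k + h *\<^sub>R p"])
      show "dist (v k + h *\<^sub>R p) (v k) < e" using h by (simp add: dist_norm)
      show "p \<bullet> (v k + h *\<^sub>R p) \<noteq> 0" using h p True by (simp add: inner_add_right)
    qed
  next
    case False
    then show ?thesis using that[of "v k"] insert.prems by simp
  qed
  have "\<exists>t. \<forall>i\<in>insert k J. t \<bullet> (v'(k := w)) i = c' i" for c' :: "'i \<Rightarrow> real"
  proof -
    obtain t where t: "\<forall>i\<in>J. t \<bullet> v' i = c' i" using c by blast
    \<comment> \<open>Adding a multiple of \<open>p\<close> corrects the value at \<open>k\<close>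
      without affecting those on \<open>J\<close>.\<close>
    define s where "s = (c' k - t \<bullet> w) / (p \<bullet> w)"
    have "(t + s *\<^sub>R p) \<bullet> w = c' k" using w by (simp add: s_def inner_add_left)
    moreover have "(t + s *\<^sub>R p) \<bullet> v' i = c' i" if "i \<in> J" for i
      using that t p0 by (simp add: inner_add_left)
    ultimately show ?thesis
      using insert.hyps by (intro exI[of _ "t + s *\<^sub>R p"]) auto
  qed
  moreover have "\<forall>i\<in>insert k J. dist ((v'(k := w)) i) (v i) < e"
    using v' w by simp
  ultimately show ?case by blast
qed

text \<open>All vectors but one are made independent, and the last is set to minus their sum. Errors
  below \<open>e / N\<close> in the \<open>N - 1\<close> free vectors keep its own error below
  \<open>e\<close>.\<close>

lemma perturb_sum_zero:
  fixes u :: "'i \<Rightarrow> 'a::euclidean_space"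
  assumes I: "finite I" "card I \<le> DIM('a) + 1" "(\<Sum>i\<in>I. u i) = 0" and e: "e > 0"
  shows "\<exists>u'. (\<forall>i\<in>I. dist (u' i) (u i) < e) \<and> (\<Sum>i\<in>I. u' i) = 0 \<and>
    (\<forall>j\<in>I. \<exists>t. \<forall>i\<in>I - {j}. t \<bullet> u' i = -1)"
proof (cases "I = {}")
  case False
  then obtain k where k: "k \<in> I" by blast
  define J where "J = I - {k}"
  have J: "finite J" "card J \<le> DIM('a)" "k \<notin> J" "I = insert k J"
    using I k unfolding J_def by auto
  define N where "N = real (card I)"
  have N: "N \<ge> 1" unfolding N_def using I False by (simp add: Suc_leI card_gt_0_iff)
  have cJ: "real (card J) = N - 1" unfolding N_def using J by simp
  obtain v where v: "\<And>i. i \<in> J \<Longrightarrow> dist (v i) (u i) < e / N"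
      and c: "\<And>c. \<exists>t. \<forall>i\<in>J. t \<bullet> v i = c i"
    using perturb_to_independent[OF J(1,2), of "e / N"] e N by fastforce
  have eN: "e / N \<le> e" using e N by (simp add: field_simps)
  define w where "w = - (\<Sum>i\<in>J. v i)"
  have uk: "u k = - (\<Sum>i\<in>J. u i)"
    using I(3) J by (simp add: eq_neg_iff_add_eq_0)
  have "dist w (u k) = norm (\<Sum>i\<in>J. v i - u i)"
    unfolding w_def uk dist_norm by (simp add: sum_subtractf norm_minus_commute)
  also have "\<dots> \<le> (\<Sum>i\<in>J. norm (v i - u i))" by (rule norm_sum)
  also have "\<dots> \<le> (\<Sum>i\<in>J. e / N)"
    by (intro sum_mono less_imp_le) (use v in \<open>simp add: dist_norm\<close>)
  also have "\<dots> = (N - 1) * (e / N)" using cJ by simp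
  also have "\<dots> < e" using e N by (simp add: field_simps)
  finally have wk: "dist w (u k) < e" .
  define u' where "u' = v(k := w)"
  have u'J: "u' i = v i" if "i \<in> J" for i using that J by (auto simp: u'_def)
  have u'k: "u' k = w" by (simp add: u'_def)
  have "\<exists>t. \<forall>i\<in>I - {j}. t \<bullet> u' i = -1" if j: "j \<in> I" for j
  proof -
    \<comment> \<open>Since the sum of the vectors is zero, the value on \<open>k\<close> is \<open>-1\<close> as soon as that on \<open>j\<close> is \<open>N - 1\<close>.\<close>
    obtain t where t: "\<forall>i\<in>J. t \<bullet> v i = (if i = j then N - 1 else -1)"
      using c[of "\<lambda>i. if i = j then N - 1 else -1"] by blast
    have "t \<bullet> w = -1" if "j \<noteq> k"
    proof -
      have jJ: "j \<in> J" using j that J by blast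
      have "t \<bullet> w = - (\<Sum>i\<in>J. if i = j then N - 1 else -1)"
        unfolding w_def inner_minus_right inner_sum_right using t by simp
      also have "(\<Sum>i\<in>J. if i = j then N - 1 else -1) = (N - 1) + (\<Sum>i\<in>J - {j}. -1)"
        using J(1) jJ by (subst sum.remove[of J j]) (auto intro!: sum.cong)
      also have "\<dots> = (N - 1) - (N - 2)"
        using card_Suc_Diff1[OF J(1) jJ] cJ by (simp flip: of_nat_Suc)
      finally show ?thesis by simp
    qed
    then have "t \<bullet> u' i = -1" if "i \<in> I - {j}" for i
      using that t J(4) u'J u'k by (cases "i = k") auto
    then show ?thesis by blast
  qed
  moreover have "\<forall>i\<in>I. dist (u' i) (u i) < e"
    using J v eN wk u'J u'k by (metis insertE less_le_trans)
  moreover have "(\<Sum>i\<in>I. u' i) = 0"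
    using J u'k u'J by (simp add: w_def)
  ultimately show ?thesis by blast
qed auto

section \<open>The covering body\<close>

text \<open>The sum condition forces \<open>t i \<bullet> u i = N - 1\<close>, so the shift that
  lowers the other directions raises direction \<open>i\<close>; the removed cap compensates for
  this.\<close>

lemma exists_body_from_directions:
  fixes K :: "'a::euclidean_space set"
  assumes K: "compact K" and I: "finite I" "I \<noteq> {}"
    and sum0: "(\<Sum>i\<in>I. u i) = 0" and e: "e > 0"
    and disj: "disjoint_family_on (\<lambda>i. near_face K (u i) e) I"
    and t: "\<And>i j. i \<in> I \<Longrightarrow> j \<in> I \<Longrightarrow> i \<noteq> j \<Longrightarrow> t j \<bullet> u i = -1"
    and "K \<noteq> {}"
  shows "\<exists>L. compact L \<and> convex L \<and>
    (\<forall>Q. finite Q \<longrightarrow> Q \<subseteq> K \<longrightarrow> card Q < card I \<longrightarrow> (\<exists>s. (+) s ` Q \<subseteq> L)) \<and>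
    \<not> (\<exists>s. (+) s ` K \<subseteq> L)"
proof -
  have "\<exists>m\<in>K. \<forall>y\<in>K. y \<bullet> u i \<le> m \<bullet> u i" for i
    by (rule continuous_attains_sup[OF K \<open>K \<noteq> {}\<close>]) (intro continuous_intros)
  then obtain m where m: "\<And>i. m i \<in> K" "\<And>i y. y \<in> K \<Longrightarrow> y \<bullet> u i \<le> m i \<bullet> u i"
    by metis
  define N where "N = real (card I)"
  have N: "N > 0" unfolding N_def using I by (simp add: card_gt_0_iff)
  \<comment> \<open>Then \<open>h * (N - 1) = e - h\<close>: cutting lowers the maximum in direction
    \<open>u i\<close> by \<open>e\<close> and the shift gives back \<open>e - h\<close>. Every
    shifted piece thus stays at least \<open>h\<close> below the maximum of \<open>K\<close> in
    every direction \<open>u i\<close>.\<close>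
  define h where "h = e / N"
  have h: "h > 0" unfolding h_def using e N by simp
  define T where "T i = K \<inter> {x. u i \<bullet> x \<le> m i \<bullet> u i - e}" for i
  have T: "x \<in> near_face K (u i) e" if "x \<in> K" "x \<notin> T i" for x i
  proof -
    have "m i \<bullet> u i < x \<bullet> u i + e"
      using that by (simp add: T_def inner_commute)
    then show ?thesis
      using that m(2)[of _ i] unfolding near_face_def by fastforce
  qed
  have tii: "t i \<bullet> u i = N - 1" if "i \<in> I" for i
  proof -
    have "0 = (\<Sum>j\<in>I. t i \<bullet> u j)" using sum0 by (simp flip: inner_sum_right)
    also have "\<dots> = t i \<bullet> u i + (\<Sum>j\<in>I - {i}. t i \<bullet> u j)" using I that by (simp add: sum.remove)
    also have "(\<Sum>j\<in>I - {i}. t i \<bullet> u j) = (\<Sum>j\<in>I - {i}. -1)"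
      using t that by (intro sum.cong) auto
    also have "\<dots> = - (N - 1)"
      unfolding N_def using I that by (auto simp: of_nat_diff Suc_leI card_gt_0_iff)
    finally show ?thesis by simp
  qed
  define L where "L = convex hull (\<Union>i\<in>I. (+) (h *\<^sub>R t i) ` T i)"
  have "compact (T i)" for i
    unfolding T_def by (intro compact_Int_closed K closed_halfspace_le)
  then have "compact L"
    unfolding L_def using I by (intro compact_convex_hull compact_UN compact_translation) auto
  moreover have "convex L" unfolding L_def by (rule convex_convex_hull)
  moreover have "\<exists>s. (+) s ` Q \<subseteq> L" if Q: "finite Q" "Q \<subseteq> K" "card Q < card I" for Q
  proof -
    \<comment> \<open>Otherwise \<open>Q\<close> has a point in each of the disjoint caps, hence at
      least \<open>card I\<close> points.\<close>
    have "\<exists>j\<in>I. Q \<subseteq> T j"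
    proof (rule ccontr)
      assume "\<not> ?thesis"
      then have "\<forall>j\<in>I. \<exists>x. x \<in> Q \<and> x \<notin> T j" by blast
      then obtain q where q: "\<And>j. j \<in> I \<Longrightarrow> q j \<in> Q \<and> q j \<notin> T j"
        by metis
      then have "q j \<in> near_face K (u j) e" if "j \<in> I" for j
        using that T Q by blast
      then have "inj_on q I"
        using disj unfolding disjoint_family_on_def inj_on_def by (metis disjoint_iff)
      moreover have "q ` I \<subseteq> Q" using q by blast
      ultimately show False using Q by (meson card_inj_on_le linorder_not_le)
    qed
    then obtain j where "j \<in> I" "Q \<subseteq> T j" by blast
    then have "(+) (h *\<^sub>R t j) ` Q \<subseteq> L"
      unfolding L_def by (intro subset_trans[OF _ hull_subset]) auto
    then show ?thesis by blast
  qed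
  moreover have "\<not> (\<exists>s. (+) s ` K \<subseteq> L)"
  proof
    assume "\<exists>s. (+) s ` K \<subseteq> L"
    then obtain s where s: "(+) s ` K \<subseteq> L" by blast
    \<comment> \<open>The translate of the maximizer \<open>m i\<close> must respect the lowered
      bound; summing over \<open>i\<close> contradicts the zero sum.\<close>
    have "s \<bullet> u i \<le> - h" if i: "i \<in> I" for i
    proof -
      have "L \<subseteq> {x. u i \<bullet> x \<le> m i \<bullet> u i - h}"
        unfolding L_def
      proof (rule hull_minimal[where S = convex, OF _ convex_halfspace_le], safe)
        fix j x assume j: "j \<in> I" and x: "x \<in> T j"
        show "u i \<bullet> (h *\<^sub>R t j + x) \<le> m i \<bullet> u i - h"
        proof (cases "i = j")
          case True
          have "h * (N - 1) = e - h" unfolding h_def using N by (simp add: field_simps)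
          then show ?thesis
            using x True tii[OF j] by (simp add: T_def inner_add_right inner_commute)
        next
          case False
          then have "t j \<bullet> u i = -1" using t i j by blast
          moreover have "x \<bullet> u i \<le> m i \<bullet> u i" using x m by (simp add: T_def)
          ultimately show ?thesis by (simp add: inner_add_right inner_commute)
        qed
      qed
      moreover have "s + m i \<in> L" using s m by blast
      ultimately show ?thesis by (auto simp: inner_add_right inner_commute)
    qed
    then have "(\<Sum>i\<in>I. s \<bullet> u i) \<le> (\<Sum>i\<in>I. - h)" by (rule sum_mono)
    also have "\<dots> < 0" using h N by (simp add: N_def)
    finally show False using sum0 by (simp flip: inner_sum_right)
  qed
  ultimately show ?thesis by blast
qed

section \<open>Directions from exposed points\<close>

lemma exposed_point_near_face:
  assumes "exposed_point_of x K"
  obtains u where "near_face K u 0 = {x}"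
proof -
  obtain u where "x \<in> K" "\<forall>y\<in>K. y \<noteq> x \<longrightarrow> y \<bullet> u < x \<bullet> u"
    using assms unfolding exposed_point_of_def by blast
  then have "near_face K u 0 = {x}" unfolding near_face_def by fastforce
  then show ?thesis using that by blast
qed

lemma near_face_add:
  assumes "near_face K u 0 = {x}" "x \<in> near_face K w 0"
  shows "near_face K (u + w) 0 = {x}"
proof -
  have x: "x \<in> K" "\<And>y. y \<in> K \<Longrightarrow> y \<bullet> u \<le> x \<bullet> u" "\<And>y. y \<in> K \<Longrightarrow> y \<bullet> w \<le> x \<bullet> w"
    using assms unfolding near_face_def by auto
  have "y = x" if y: "y \<in> near_face K (u + w) 0" for y
  proof -
    have yK: "y \<in> K" and "x \<bullet> (u + w) \<le> y \<bullet> (u + w)"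
      using y x(1) unfolding near_face_def by auto
    then have "x \<bullet> u \<le> y \<bullet> u"
      using x(3)[OF yK] by (simp add: inner_add_right)
    then have "y \<in> near_face K u 0"
      using yK x(2) unfolding near_face_def by fastforce
    then show ?thesis using assms by blast
  qed
  moreover have "x \<in> near_face K (u + w) 0"
    unfolding near_face_def using x by (auto simp: inner_add_right intro: add_mono)
  ultimately show ?thesis by blast
qed

text \<open>Every point but \<open>z\<close> keeps an exposing direction, and \<open>z\<close>
  receives the balancing vector \<open>w\<close>. If the face of \<open>w\<close> contains some
  \<open>j\<close> in \<open>D\<close>, then \<open>u j + w\<close> still exposes \<open>j\<close>,
  and \<open>w\<close> can be absorbed there.\<close>

lemma exposed_points_directions:
  fixes K :: "'a::euclidean_space set"
  assumes K: "compact K" and E: "finite E" "card E \<ge> 2" "\<And>x. x \<in> E \<Longrightarrow> exposed_point_of x K"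
  shows "\<exists>u. (\<Sum>x\<in>E. u x) = 0 \<and> disjoint_family_on (\<lambda>x. near_face K (u x) 0) E"
proof -
  obtain z where z: "z \<in> E" using E by fastforce
  define D where "D = E - {z}"
  have D: "finite D" "z \<notin> D" "E = insert z D" unfolding D_def using E z by auto
  have "D \<noteq> {}" using E D by auto
  have "\<exists>u. near_face K u 0 = {x}" if "x \<in> E" for x
    using E that exposed_point_near_face by metis
  then obtain u where u: "\<And>x. x \<in> E \<Longrightarrow> near_face K (u x) 0 = {x}" by metis
  define w where "w = - (\<Sum>x\<in>D. u x)"
  show ?thesis
  proof (cases "D \<inter> near_face K w 0 = {}")
    case True
    have "(\<Sum>x\<in>E. (u(z := w)) x) = 0"
    proof -
      have "(\<Sum>x\<in>D. (u(z := w)) x) = (\<Sum>x\<in>D. u x)"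
        using D by (intro sum.cong) auto
      then show ?thesis using D by (simp add: w_def)
    qed
    moreover have "disjoint_family_on (\<lambda>x. near_face K ((u(z := w)) x) 0) E"
      unfolding disjoint_family_on_def using True u D by auto
    ultimately show ?thesis by blast
  next
    case False
    then obtain j where j: "j \<in> D" "j \<in> near_face K w 0" by blast
    \<comment> \<open>The vectors \<open>a\<close> on \<open>D\<close> already sum to zero, so \<open>a z\<close> is scaled down until subtracting it
        from \<open>a j\<close> does not make the faces meet.\<close>
    define a where "a = u(j := u j + w)"
    have a: "near_face K (a x) 0 = {x}" if "x \<in> E" for x
      using near_face_add[OF u j(2)] u that unfolding a_def by (cases "x = j") auto
    have "(\<Sum>x\<in>D. a x) = (u j + w) + (\<Sum>x\<in>D - {j}. u x)"
      unfolding a_def using D j by (subst sum.remove[of D j]) (auto intro!: sum.cong)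
    also have "\<dots> = (\<Sum>x\<in>D. u x) + w"
      using D j by (simp add: sum.remove[of D j])
    finally have sumD: "(\<Sum>x\<in>D. a x) = 0" by (simp add: w_def)
    have "disjoint_family_on (\<lambda>x. near_face K (a x) 0) E"
      unfolding disjoint_family_on_def using a by auto
    then obtain e where e: "e > 0" and stable: "\<And>b. \<forall>x\<in>E. dist (b x) (a x) < e \<Longrightarrow>
        disjoint_family_on (\<lambda>x. near_face K (b x) e) E"
      using disjoint_near_face_stable[OF K E(1)] by metis
    \<comment> \<open>The shift of \<open>a j\<close> by \<open>h *\<^sub>R a z\<close> stays below
      the stability bound; the added 1 avoids division by zero.\<close>
    define h where "h = e / (1 + norm (a z))"
    have "1 + norm (a z) > 0" by (simp add: add_pos_nonneg)
    then have h: "h > 0" "h * norm (a z) < e"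
      unfolding h_def using e by (simp_all add: field_simps)
    have jz: "j \<noteq> z" using j D by blast
    define b where "b = a(j := a j - h *\<^sub>R a z)"
    have "\<forall>x\<in>E. dist (b x) (a x) < e"
      unfolding b_def using e h by (auto simp: dist_norm)
    then have disj: "disjoint_family_on (\<lambda>x. near_face K (b x) e) E" by (rule stable)
    \<comment> \<open>Positive scaling preserves the face at \<open>z\<close>, while the sum becomes
      zero again.\<close>
    define c where "c = b(z := h *\<^sub>R a z)"
    have "near_face K (c x) 0 \<subseteq> near_face K (b x) e" for x
    proof -
      have "near_face K (c x) 0 = near_face K (b x) 0"
        unfolding c_def b_def using near_face_scale[OF h(1)] jz by auto
      then show ?thesis using near_face_mono[of 0 e] e by simp
    qed
    then have "disjoint_family_on (\<lambda>x. near_face K (c x) 0) E"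
      using disj unfolding disjoint_family_on_def by blast
    moreover have "(\<Sum>x\<in>E. c x) = 0"
    proof -
      have "(\<Sum>x\<in>D. c x) = (\<Sum>x\<in>D. b x)"
        unfolding c_def using D by (intro sum.cong) auto
      also have "\<dots> = (a j - h *\<^sub>R a z) + (\<Sum>x\<in>D - {j}. a x)"
        unfolding b_def using D j by (subst sum.remove[of D j]) (auto intro!: sum.cong)
      also have "\<dots> = (\<Sum>x\<in>D. a x) - h *\<^sub>R a z"
        using D j by (simp add: sum.remove[of D j])
      finally have "(\<Sum>x\<in>D. c x) = - (h *\<^sub>R a z)" using sumD by simp
      then show ?thesis using D by (simp add: c_def)
    qed
    ultimately show ?thesis by blast
  qed
qed

theorem theorem3p7:
  fixes K :: "'a::euclidean_space set" and d :: nat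
  assumes "1 \<le> d" and "d \<le> DIM('a) - 1"
    and "compact K" and "convex K"
    and "\<exists>E. finite E \<and> card E = d + 2 \<and> (\<forall>x\<in>E. exposed_point_of x K)"
  shows "\<exists>L :: 'a set. compact L \<and> convex L \<and>
           (\<forall>xi. subspace xi \<and> dim xi = d \<longrightarrow>
              (\<exists>t. (\<lambda>x. t + x) ` proj_set xi K \<subseteq> proj_set xi L)) \<and>
           \<not> (\<exists>t. (\<lambda>x. t + x) ` K \<subseteq> L)"
proof -
  obtain E where E: "finite E" "card E = d + 2" "\<And>x. x \<in> E \<Longrightarrow> exposed_point_of x K"
    using assms(5) by blast
  have "E \<noteq> {}" using E by auto
  then have "K \<noteq> {}" using E(3) unfolding exposed_point_of_def by blast
  \<comment> \<open>This lets \<open>d + 1\<close> of the \<open>d + 2\<close> directions be made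
    independent.\<close>
  have "card E \<le> DIM('a) + 1" using assms(1,2) E(2) by linarith
  obtain u where u: "(\<Sum>x\<in>E. u x) = 0" "disjoint_family_on (\<lambda>x. near_face K (u x) 0) E"
    using exposed_points_directions[OF assms(3) E(1) _ E(3)] E(2) by auto
  obtain e where e: "e > 0" and stable: "\<And>v. \<forall>x\<in>E. dist (v x) (u x) < e \<Longrightarrow>
      disjoint_family_on (\<lambda>x. near_face K (v x) e) E"
    using disjoint_near_face_stable[OF assms(3) E(1) u(2)] by metis
  obtain v where v: "\<forall>x\<in>E. dist (v x) (u x) < e" "(\<Sum>x\<in>E. v x) = 0"
      and t: "\<forall>y\<in>E. \<exists>t. \<forall>x\<in>E - {y}. t \<bullet> v x = -1"
    using perturb_sum_zero[OF E(1) \<open>card E \<le> DIM('a) + 1\<close> u(1) e] by blast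
  from t obtain t where "\<forall>y\<in>E. \<forall>x\<in>E - {y}. t y \<bullet> v x = -1" by metis
  then obtain L where L: "compact L" "convex L"
      "\<And>Q. finite Q \<Longrightarrow> Q \<subseteq> K \<Longrightarrow> card Q < card E \<Longrightarrow> \<exists>s. (+) s ` Q \<subseteq> L"
      "\<not> (\<exists>s. (+) s ` K \<subseteq> L)"
    using exists_body_from_directions[OF assms(3) E(1) \<open>E \<noteq> {}\<close> v(2) e stable[OF v(1)], of t] \<open>K \<noteq> {}\<close>
    by auto
  have "\<exists>t. (+) t ` proj_set xi K \<subseteq> proj_set xi L" if "subspace xi" "dim xi = d" for xi
    unfolding proj_set_def
  proof (rule linear_image_contains_translate[OF linear_orth_proj[OF that(1)] that(1) _ L(1,2)])
    show "range (orth_proj xi) \<subseteq> xi" using orth_proj_mem_orthogonal[OF that(1)] by blast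
    \<comment> \<open>The Helly number \<open>d + 1\<close> of \<open>xi\<close> is one less than
      \<open>card E\<close>.\<close>
    show "\<And>Q. finite Q \<Longrightarrow> Q \<subseteq> K \<Longrightarrow> card Q \<le> dim xi + 1 \<Longrightarrow> \<exists>t. (+) t ` Q \<subseteq> L"
      using L(3) E(2) that(2) by simp
  qed
  with L(1,2,4) show ?thesis by blast
qed

end
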